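(* Let $G$ be a second countable locally compact topological group. If a nonsingular $G$-system $\mathbf{X}=(X,\mathcal{B},\mu,G)$ is strongly almost transitive (SAT), then it is ergodic with isometric coefficients (EIC).
   Context: A nonsingular $G$-system $\mathbf{X}=(X,\mathcal{B},\mu,G)$ is a measurable action of $G$ on a standard Lebesgue probability space $(X,\mathcal{B},\mu)$ preserving the measure class of $\mu$: $\mu(A)=0\iff\mu(gA)=0$ for all $A\in\mathcal{B}$, $g\in G$. SAT: for every measurable $A\subset X$ with $\mu(A)>0$ there is a sequence $\{g_n\}\subset G$ with $\mu(g_nA)\to 1$. EIC: there is no non-constant Borel measurable equivariant map $\phi:X\to Z$, where $(Z,d)$ is a separable metric space on which $G$ acts by isometries. Here equivariant means that for each $g\in G$, $\phi(gx)=g\phi(x)$ for $\mu$-a.e. $x$, and non-constant means not $\mu$-a.e. equal to a constant. *)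

theory Defs
  imports "HOL-Probability.Probability" "HOL-Algebra.Group_Action"
begin

definition borel_of :: "'a topology \<Rightarrow> 'a measure" where
  "borel_of T = sigma (topspace T) {U. openin T U}"

definition standard_borel :: "'a measure \<Rightarrow> bool" where
  "standard_borel N \<longleftrightarrow>
     (\<exists>S. completely_metrizable_space S \<and> second_countable S \<and>
          space N = topspace S \<and> sets N = sets (borel_of S))"

text \<open>
  A standard Lebesgue space is a standard Borel space with a Borel probability measure, where the
  measure may or may not have been completed; both readings are covered. Here \<open>N\<close> is the underlying
  standard Borel space of \<open>M\<close>.
\<close>

definition lebesgue_model :: "'a measure \<Rightarrow> 'a measure \<Rightarrow> bool" where
  "lebesgue_model N M \<longleftrightarrow> standard_borel N \<and> prob_space N \<and> (M = N \<or> M = completion N)"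

locale topological_group = group G for G (structure) +
  fixes T :: "'a topology"
  assumes topspace_eq: "topspace T = carrier G"
    and continuous_mult: "continuous_map (prod_topology T T) T (\<lambda>(g, h). g \<otimes> h)"
    and continuous_inv: "continuous_map T T (\<lambda>g. inv g)"

text \<open>
  If \<open>M\<close> is complete, the action map is required to pull Borel sets (the sets of \<open>N\<close>) back to
  measurable sets, as usual for maps into a Lebesgue space. For non-Borel sets in \<open>M\<close> the pullback
  along the joint map need not lie in the product \<open>\<sigma>\<close>-algebra; along each single group element it
  is measurable by nonsingularity. The translate of a set \<open>A\<close> by \<open>g\<close> is the image \<open>act g ` A\<close>.
\<close>

locale nonsingular_system =
  topological_group G T + group_action G "space M" act
  for G (structure) and T and M :: "'x measure" and act +
  assumes measurable_action:
      "\<exists>N. lebesgue_model N M \<and> (\<lambda>(g, x). act g x) \<in> borel_of T \<Otimes>\<^sub>M M \<rightarrow>\<^sub>M N"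
    and nonsingular:
      "\<And>g A. g \<in> carrier G \<Longrightarrow> A \<in> sets M \<Longrightarrow>
         A \<in> null_sets M \<longleftrightarrow> act g ` A \<in> null_sets M"

definition SAT :: "('g, 'b) monoid_scheme \<Rightarrow> 'x measure \<Rightarrow> ('g \<Rightarrow> 'x \<Rightarrow> 'x) \<Rightarrow> bool" where
  "SAT G M act \<longleftrightarrow>
     (\<forall>A\<in>sets M. measure M A > 0 \<longrightarrow>
        (\<exists>g :: nat \<Rightarrow> 'g. (\<forall>n. g n \<in> carrier G) \<and>
           (\<lambda>n. measure M (act (g n) ` A)) \<longlonglongrightarrow> 1))"

definition isometric_action ::
    "('g, 'b) monoid_scheme \<Rightarrow> 'z metric \<Rightarrow> ('g \<Rightarrow> 'z \<Rightarrow> 'z) \<Rightarrow> bool" where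
  "isometric_action G Z \<psi> \<longleftrightarrow>
     group_action G (mspace Z) \<psi> \<and>
     (\<forall>g\<in>carrier G. \<forall>z\<in>mspace Z. \<forall>w\<in>mspace Z. mdist Z (\<psi> g z) (\<psi> g w) = mdist Z z w)"

text \<open>
  A definition cannot quantify over types, so the type in which the points of the coefficient space
  \<open>Z\<close> live is a parameter. A theorem concluding \<open>EIC TYPE('z)\<close> with \<open>'z\<close> a type variable covers
  all separable metric spaces. The action on \<open>Z\<close> is not required to be continuous in the group
  variable.
\<close>

definition EIC :: "'z itself \<Rightarrow> ('g, 'b) monoid_scheme \<Rightarrow> 'x measure \<Rightarrow> ('g \<Rightarrow> 'x \<Rightarrow> 'x) \<Rightarrow> bool" where
  "EIC _ G M act \<longleftrightarrow>
     \<not> (\<exists>(Z :: 'z metric) \<psi> \<phi>.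
          separable_space (mtopology_of Z) \<and>
          isometric_action G Z \<psi> \<and>
          \<phi> \<in> M \<rightarrow>\<^sub>M borel_of (mtopology_of Z) \<and>
          (\<forall>g\<in>carrier G. AE x in M. \<phi> (act g x) = \<psi> g (\<phi> x)) \<and>
          \<not> (\<exists>c\<in>mspace Z. AE x in M. \<phi> x = c))"

end

theory Submission
  imports Defs
begin

text \<open>
  Let \<open>\<nu>\<close> be the image of the measure under an equivariant map \<open>\<phi>\<close>. By SAT, every ball \<open>B\<close> of positive
  \<open>\<nu>\<close>-measure has translates \<open>gB\<close> with \<open>\<nu> (gB)\<close> close to 1, and since the action is isometric these
  translates are again balls of the same radius. Two distinct points of the support of \<open>\<nu>\<close> have
  disjoint neighbourhoods of positive measure that no small ball meets simultaneously, while a ball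
  of measure close to 1 must meet both. So the support is a single point; as the space is separable,
  the support has full measure, and \<open>\<phi>\<close> is constant.
\<close>

lemma space_borel_of: "space (borel_of T) = topspace T"
  unfolding borel_of_def by (rule space_measure_of) (auto dest: openin_subset)

lemma openin_imp_borel_of: "openin T U \<Longrightarrow> U \<in> sets (borel_of T)"
  unfolding borel_of_def by (subst sets_measure_of) (auto dest: openin_subset)

lemma mball_of_in_borel_of: "mball_of Z z r \<in> sets (borel_of (mtopology_of Z))"
  unfolding mtopology_of_def mball_of_def
  by (intro openin_imp_borel_of Metric_space.openin_mball) simp

text \<open>If some ball around \<open>f x\<close> has null preimage, separability places
  \<open>f x\<close> in a smaller such ball whose centre lies in a countable dense set and whose
  radius is 1/(k+1). Only countably many balls have this form, so the preimages of the null ones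
  together form a null set.\<close>

lemma (in Metric_space) AE_in_support:
  assumes "separable_space mtopology"
    and f: "f \<in> space N \<rightarrow> M"
    and meas: "\<And>z r. z \<in> M \<Longrightarrow> f -` mball z r \<inter> space N \<in> sets N"
  shows "AE x in N. \<forall>r>0. f -` mball (f x) r \<inter> space N \<notin> null_sets N"
proof -
  obtain C where C: "countable C" "C \<subseteq> M" "mtopology closure_of C = M"
    using assms(1) unfolding separable_space_def by auto
  let ?null = "\<lambda>c k. f -` mball c (inverse (Suc k)) \<inter> space N \<in> null_sets N"
  have "AE x in N. ?null c k \<longrightarrow> f x \<notin> mball c (inverse (Suc k))" for c k
  proof (cases "?null c k")
    case True
    then show ?thesis
      by (intro AE_I'[OF True]) auto
  qed simp
  then have "AE x in N. \<forall>c\<in>C. \<forall>k. ?null c k \<longrightarrow> f x \<notin> mball c (inverse (Suc k))"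
    using C(1) by (simp add: AE_ball_countable AE_all_countable)
  then show ?thesis
  proof (rule AE_mp, intro AE_I2 impI allI)
    fix x and r :: real
    assume x: "x \<in> space N" and r: "r > 0"
      and *: "\<forall>c\<in>C. \<forall>k. ?null c k \<longrightarrow> f x \<notin> mball c (inverse (Suc k))"
    have fx: "f x \<in> M"
      using f x by auto
    \<comment> \<open>A ball of radius below r/2 that contains \<open>f x\<close> lies within
      distance r of \<open>f x\<close>, hence the factor 1/2.\<close>
    obtain k where k: "inverse (real (Suc k)) < r / 2"
      using reals_Archimedean[of "r / 2"] r by auto
    have "f x \<in> mtopology closure_of C"
      using C fx by simp
    then have "\<forall>e>0. \<exists>c\<in>C. c \<in> mball (f x) e"
      by (simp add: metric_closure_of del: in_mball)
    moreover have "inverse (real (Suc k)) > 0"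
      by simp
    ultimately obtain c where c: "c \<in> C" "c \<in> mball (f x) (inverse (Suc k))"
      by blast
    have sub: "mball c (inverse (Suc k)) \<subseteq> mball (f x) r"
    proof
      fix y assume y: "y \<in> mball c (inverse (Suc k))"
      then show "y \<in> mball (f x) r"
        using triangle[of "f x" c y] c k by (auto simp del: of_nat_Suc)
    qed
    have "f x \<in> mball c (inverse (Suc k))"
      using c commute by (auto simp del: of_nat_Suc)
    then have "\<not> ?null c k"
      using * c by blast
    \<comment> \<open>\<open>N\<close> may be incomplete, so a subset of a null set counts as null
      only once it is known to be measurable.\<close>
    moreover have "f -` mball c (inverse (Suc k)) \<inter> space N \<in> sets N"
      using meas c by (auto simp del: of_nat_Suc)
    ultimately show "f -` mball (f x) r \<inter> space N \<notin> null_sets N"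
      using sub null_sets_subset[of "f -` mball (f x) r \<inter> space N" N] by blast
  qed
qed

lemma lebesgue_model_prob_space:
  assumes "lebesgue_model N M"
  shows "prob_space M"
  using assms unfolding lebesgue_model_def
  by (auto intro!: prob_spaceI simp: prob_space.emeasure_space_1)

text \<open>
  The image \<open>act g ` A\<close> need not be known to be measurable: if it is not, its measure is 0.
\<close>

lemma (in prob_space) SAT_equivariant_ball_measure:
  assumes act: "group_action G (space M) act"
    and SAT: "SAT G M act"
    and Z: "isometric_action G Z \<psi>"
    and \<phi>: "\<phi> \<in> M \<rightarrow>\<^sub>M borel_of (mtopology_of Z)"
    and equiv: "\<And>g. g \<in> carrier G \<Longrightarrow> AE x in M. \<phi> (act g x) = \<psi> g (\<phi> x)"
    and pos: "prob (\<phi> -` mball_of Z z r \<inter> space M) > 0"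
    and z: "z \<in> mspace Z" and e: "e > 0"
  obtains w where "w \<in> mspace Z" "prob (\<phi> -` mball_of Z w r \<inter> space M) > 1 - e"
proof -
  interpret act: group_action G "space M" act by fact
  interpret \<psi>: group_action G "mspace Z" \<psi>
    using Z by (simp add: isometric_action_def)
  interpret group G
    using act.group_hom group_hom.axioms(1) by blast
  have space_borel: "space (borel_of (mtopology_of Z)) = mspace Z"
    by (simp add: space_borel_of)
  have ball: "\<phi> -` mball_of Z w r \<inter> space M \<in> sets M" for w
    using \<phi> mball_of_in_borel_of by (rule measurable_sets)
  define A where "A = \<phi> -` mball_of Z z r \<inter> space M"
  obtain g :: "nat \<Rightarrow> 'b" where g: "\<And>n. g n \<in> carrier G"
    and lim: "(\<lambda>n. prob (act (g n) ` A)) \<longlonglongrightarrow> 1"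
    using SAT pos ball unfolding SAT_def A_def by blast
  have "1 - e < 1"
    using e by simp
  from order_tendstoD(1)[OF lim this] obtain n where n: "1 - e < prob (act (g n) ` A)"
    by (auto simp: eventually_sequentially)
  let ?g = "g n"
  let ?h = "inv\<^bsub>G\<^esub> ?g"
  have h: "?h \<in> carrier G"
    using g by simp
  \<comment> \<open>Equivariance is applied to the inverse \<open>?h\<close> at the point
    \<open>x\<close> of the image, not to \<open>?g\<close> at its preimage. The exceptional null
    set is thus a set of points \<open>x\<close> and is never translated.\<close>
  have "AE x in M. x \<in> act ?g ` A \<longrightarrow> x \<in> \<phi> -` mball_of Z (\<psi> ?g z) r \<inter> space M"
    using equiv[OF h]
  proof (rule AE_mp, intro AE_I2 impI)
    fix x assume x: "x \<in> space M" and eq: "\<phi> (act ?h x) = \<psi> ?h (\<phi> x)" and "x \<in> act ?g ` A"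
    then obtain y where y: "y \<in> A" "x = act ?g y"
      by blast
    have "act ?h x = y"
      using act.orbit_sym_aux[OF g, of y n] y unfolding A_def by auto
    then have in_ball: "\<psi> ?h (\<phi> x) \<in> mball_of Z z r"
      using eq y unfolding A_def by simp
    have \<phi>x: "\<phi> x \<in> mspace Z"
      using measurable_space[OF \<phi> x] space_borel by simp
    have gz: "\<psi> ?g z \<in> mspace Z"
      using \<psi>.element_image[OF g z] by simp
    have "mdist Z (\<psi> ?g z) (\<phi> x) = mdist Z (\<psi> ?h (\<psi> ?g z)) (\<psi> ?h (\<phi> x))"
      using Z h gz \<phi>x unfolding isometric_action_def by simp
    also have "\<psi> ?h (\<psi> ?g z) = z"
      using \<psi>.orbit_sym_aux[OF g z, of n] by simp
    also have "mdist Z z (\<psi> ?h (\<phi> x)) < r"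
      using in_ball by (simp add: mball_of_def Metric_space.in_mball)
    finally show "x \<in> \<phi> -` mball_of Z (\<psi> ?g z) r \<inter> space M"
      using x \<phi>x gz by (simp add: mball_of_def Metric_space.in_mball)
  qed
  \<comment> \<open>Monotonicity almost everywhere asks for measurability of the larger set only,
    here the preimage of a ball.\<close>
  then have "prob (act ?g ` A) \<le> prob (\<phi> -` mball_of Z (\<psi> ?g z) r \<inter> space M)"
    by (rule finite_measure_mono_AE) (rule ball)
  with n \<psi>.element_image[OF g z] that show thesis
    by (metis order_less_le_trans)
qed

theorem proposition3p3:
  fixes G :: "('g, 'b) monoid_scheme" and T :: "'g topology"
    and M :: "'x measure" and act :: "'g \<Rightarrow> 'x \<Rightarrow> 'x"
  assumes "topological_group G T" "second_countable T" "locally_compact_space T"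
    and "nonsingular_system G T M act"
    and "SAT G M act"
  shows "EIC TYPE('z) G M act"
proof -
  interpret nonsingular_system G T M act by fact
  interpret prob_space M
    using measurable_action lebesgue_model_prob_space by blast
  have act: "group_action G (space M) act"
    by unfold_locales
  have "\<exists>c\<in>mspace Z. AE x in M. \<phi> x = c"
    if sep: "separable_space (mtopology_of Z)" and iso: "isometric_action G Z \<psi>"
      and \<phi>: "\<phi> \<in> M \<rightarrow>\<^sub>M borel_of (mtopology_of Z)"
      and equiv: "\<forall>g\<in>carrier G. AE x in M. \<phi> (act g x) = \<psi> g (\<phi> x)"
    for Z :: "'z metric" and \<psi> \<phi>
  proof -
    interpret Z: Metric_space "mspace Z" "mdist Z"
      by simp
    have \<phi>_space: "\<phi> x \<in> mspace Z" if "x \<in> space M" for x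
      using measurable_space[OF \<phi> that] by (simp add: space_borel_of)
    let ?B = "\<lambda>z r. \<phi> -` Z.mball z r \<inter> space M"
    have meas: "?B z r \<in> sets M" for z r
      using measurable_sets[OF \<phi> mball_of_in_borel_of[of Z z r]] by (simp add: mball_of_def)
    let ?supp = "\<lambda>z. \<forall>r>0. prob (?B z r) > 0"
    have "AE x in M. \<forall>r>0. ?B (\<phi> x) r \<notin> null_sets M"
      using sep \<phi>_space meas by (intro Z.AE_in_support) (auto simp: mtopology_of_def)
    then have supp: "AE x in M. ?supp (\<phi> x)"
      by (rule AE_mp) (auto simp: null_sets_def emeasure_eq_measure meas zero_less_measure_iff)
    have unique: "z = w" if z: "z \<in> mspace Z" "?supp z" and w: "w \<in> mspace Z" "?supp w" for z w
    proof (rule ccontr)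
      assume "z \<noteq> w"
      \<comment> \<open>A ball of radius r meeting the r-balls around \<open>z\<close> and
        \<open>w\<close> would force their distance to be below 4r, which is that distance
        itself.\<close>
      define r where "r = mdist Z z w / 4"
      have r: "r > 0"
        using \<open>z \<noteq> w\<close> z w by (simp add: r_def)
      \<comment> \<open>Two events whose probabilities sum to more than 1 cannot be
        disjoint.\<close>
      have meets: "\<exists>x\<in>space M. \<phi> x \<in> Z.mball u r \<and> \<phi> x \<in> Z.mball v r"
        if "prob (?B v r) > 1 - prob (?B u r)" for u v
      proof (rule ccontr)
        assume "\<not> ?thesis"
        then have "?B u r \<inter> ?B v r = {}"
          by blast
        then have "prob (?B u r) + prob (?B v r) = prob (?B u r \<union> ?B v r)"
          using meas by (simp add: finite_measure_Union)
        with prob_le_1[of "?B u r \<union> ?B v r"] that show False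
          by linarith
      qed
      \<comment> \<open>The minimum lets a single translate of the ball around \<open>z\<close>,
        centred at \<open>v\<close>, be large enough to meet both balls.\<close>
      define e where "e = min (prob (?B z r)) (prob (?B w r))"
      have "e > 0"
        using z w r by (simp add: e_def)
      moreover have "prob (\<phi> -` mball_of Z z r \<inter> space M) > 0"
        using z r by (simp add: mball_of_def)
      ultimately obtain v where
        vZ: "v \<in> mspace Z" and "prob (\<phi> -` mball_of Z v r \<inter> space M) > 1 - e"
        using SAT_equivariant_ball_measure[OF act \<open>SAT G M act\<close> iso \<phi> bspec[OF equiv] _ z(1)]
        by blast
      then have "prob (?B v r) > 1 - e"
        by (simp add: mball_of_def)
      then have v: "prob (?B v r) > 1 - prob (?B z r)" "prob (?B v r) > 1 - prob (?B w r)"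
        unfolding e_def by linarith+
      obtain x where x: "\<phi> x \<in> Z.mball z r" "\<phi> x \<in> Z.mball v r"
        using meets[OF v(1)] by blast
      obtain y where y: "\<phi> y \<in> Z.mball w r" "\<phi> y \<in> Z.mball v r"
        using meets[OF v(2)] by blast
      have "mdist Z z v < 2 * r"
        using x Z.triangle[of z "\<phi> x" v] Z.commute[of v "\<phi> x"] by auto
      moreover have "mdist Z v w < 2 * r"
        using y Z.triangle[of v "\<phi> y" w] Z.commute[of w "\<phi> y"] by auto
      ultimately show False
        using Z.triangle[of z v w] z w vZ by (simp add: r_def)
    qed
    \<comment> \<open>A property holding almost everywhere in a probability space holds at some
      point; the value of \<open>\<phi>\<close> there serves as the constant.\<close>
    have "\<exists>x\<in>space M. ?supp (\<phi> x)"
    proof (rule ccontr)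
      assume none: "\<not> ?thesis"
      have "AE x in M. False"
        using supp by (rule AE_mp, intro AE_I2 impI) (use none in blast)
      then show False
        by simp
    qed
    then obtain x0 where x0: "x0 \<in> space M" "?supp (\<phi> x0)"
      by blast
    have "AE x in M. \<phi> x = \<phi> x0"
      using supp
    proof (rule AE_mp, intro AE_I2 impI)
      fix x assume "x \<in> space M" "?supp (\<phi> x)"
      then show "\<phi> x = \<phi> x0"
        using unique[of "\<phi> x" "\<phi> x0"] x0 \<phi>_space by blast
    qed
    then show ?thesis
      using \<phi>_space x0 by blast
  qed
  then show ?thesis
    unfolding EIC_def by blast
qed

end
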